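(* Let $n\in\mathbb{N}$, let $A_1,A_2\in\mathbb{R}^{n\times n}$ be diagonal matrices with positive diagonal entries, let $B_R,B_L\in\mathbb{R}^{2n\times 2n}$ and $P\in\mathbb{R}^{2n}$, and consider the affine linear coupling function $\Psi_Q:\mathbb{R}^{2n}\times\mathbb{R}^{2n}\to\mathbb{R}^{2n}$, $$\Psi_Q[Q_R,Q_L]=B_RQ_R-B_LQ_L-P.$$ Define the block matrices in $\mathbb{R}^{2n\times 2n}$ $$\tilde R^-=\begin{pmatrix}-(\sqrt{A_1})^{-1}&0\\ I&0\end{pmatrix},\qquad \tilde R^+=\begin{pmatrix}0&(\sqrt{A_2})^{-1}\\0&I\end{pmatrix}.$$ Suppose the matrix $B_R\tilde R^--B_L\tilde R^+$ is regular (invertible). Then the Riemann solver corresponding to $\Psi_Q$ is well defined, i.e., for all trace data $(Q_0^-,Q_0^+)\in\mathbb{R}^{2n}\times\mathbb{R}^{2n}$ there is exactly one pair $(Q_R,Q_L)\in\mathbb{R}^{2n}\times\mathbb{R}^{2n}$ with $Q_R\in\mathcal{L}^-(Q_0^-)$, $Q_L\in\mathcal{L}^+(Q_0^+)$ and $\Psi_Q[Q_R,Q_L]=0$, and its output is $$Q_R=Q_0^-+\tilde R^-\Sigma,\qquad Q_L=Q_0^++\tilde R^+\Sigma,$$ where $\Sigma\in\mathbb{R}^{2n}$ is the unique solution of the linear system $$\left(B_R\tilde R^--B_L\tilde R^+\right)\Sigma=P+B_LQ_0^+-B_RQ_0^-.$$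
   Context: For a diagonal matrix $A_i$ with positive diagonal entries, $\sqrt{A_i}$ is the diagonal matrix of the positive square roots of the entries; $I$ is the $n\times n$ identity matrix and $0$ denotes $n\times n$ zero blocks. For $Q_0^*\in\mathbb{R}^{2n}$ define $$\mathcal{L}^-(Q_0^* )=\{Q_0^*+R_1^-\Sigma^-:\Sigma^-\in\mathbb{R}^n\},\qquad \mathcal{L}^+(Q_0^* )=\{Q_0^*+R_2^+\Sigma^+:\Sigma^+\in\mathbb{R}^n\},$$ where $R_1^-=\begin{pmatrix}-(\sqrt{A_1})^{-1}\\ I\end{pmatrix}\in\mathbb{R}^{2n\times n}$ and $R_2^+=\begin{pmatrix}(\sqrt{A_2})^{-1}\\ I\end{pmatrix}\in\mathbb{R}^{2n\times n}$. These are the sets of states connected to $Q_0^*$ by Lax curves of negative speed (relaxation system on the left half-axis) and of positive speed (right half-axis), respectively. The Riemann solver corresponding to a coupling function $\Psi_Q$ is the map $(Q_0^-,Q_0^+)\mapsto(Q_R,Q_L)$ defined by the conditions $Q_R\in\mathcal{L}^-(Q_0^-)$, $Q_L\in\mathcal{L}^+(Q_0^+)$ and $\Psi_Q[Q_R,Q_L]=0$. *)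

theory Defs
  imports "HOL-Analysis.Analysis"
begin

definition diagonal_matrix :: "real^'n^'n \<Rightarrow> bool"
  where "diagonal_matrix A \<longleftrightarrow> (\<forall>i j. i \<noteq> j \<longrightarrow> A $ i $ j = 0)"

definition diag_sqrt :: "real^'n^'n \<Rightarrow> real^'n^'n"
  where "diag_sqrt A = (\<chi> i j. if i = j then sqrt (A $ i $ i) else 0)"

text \<open>The space of real vectors of dimension \<open>2n\<close> is indexed by the sum type \<open>'n + 'n\<close>:
  the left summand indexes the first \<open>n\<close> components (or rows, or columns), the right summand
  the last \<open>n\<close>.\<close>

definition block_column :: "real^'k^'m \<Rightarrow> real^'k^'n \<Rightarrow> real^'k^('m + 'n)"
  where "block_column A B =
    (\<chi> i j. case i of Inl a \<Rightarrow> A $ a $ j | Inr b \<Rightarrow> B $ b $ j)"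

definition block_matrix ::
    "real^'k^'m \<Rightarrow> real^'l^'m \<Rightarrow> real^'k^'n \<Rightarrow> real^'l^'n \<Rightarrow> real^('k + 'l)^('m + 'n)"
  where "block_matrix A B C D =
    (\<chi> i j. case i of
        Inl a \<Rightarrow> (case j of Inl c \<Rightarrow> A $ a $ c | Inr d \<Rightarrow> B $ a $ d)
      | Inr b \<Rightarrow> (case j of Inl c \<Rightarrow> C $ b $ c | Inr d \<Rightarrow> D $ b $ d))"

definition R_minus :: "real^'n^'n \<Rightarrow> real^'n^('n + 'n)"
  where "R_minus A = block_column (- matrix_inv (diag_sqrt A)) (mat 1)"

definition R_plus :: "real^'n^'n \<Rightarrow> real^'n^('n + 'n)"
  where "R_plus A = block_column (matrix_inv (diag_sqrt A)) (mat 1)"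

definition R_tilde_minus :: "real^'n^'n \<Rightarrow> real^('n + 'n)^('n + 'n)"
  where "R_tilde_minus A = block_matrix (- matrix_inv (diag_sqrt A)) 0 (mat 1) 0"

definition R_tilde_plus :: "real^'n^'n \<Rightarrow> real^('n + 'n)^('n + 'n)"
  where "R_tilde_plus A = block_matrix 0 (matrix_inv (diag_sqrt A)) 0 (mat 1)"

text \<open>The states connected to \<open>Q\<close> by Lax curves of negative and of positive speed.\<close>

definition lax_minus :: "real^'n^'n \<Rightarrow> real^('n + 'n) \<Rightarrow> (real^('n + 'n)) set"
  where "lax_minus A Q = {Q + R_minus A *v \<Sigma> | \<Sigma>. True}"

definition lax_plus :: "real^'n^'n \<Rightarrow> real^('n + 'n) \<Rightarrow> (real^('n + 'n)) set"
  where "lax_plus A Q = {Q + R_plus A *v \<Sigma> | \<Sigma>. True}"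

definition affine_coupling ::
    "real^('n::finite + 'n)^('n + 'n) \<Rightarrow> real^('n + 'n)^('n + 'n) \<Rightarrow> real^('n + 'n)
      \<Rightarrow> real^('n + 'n) \<Rightarrow> real^('n + 'n) \<Rightarrow> real^('n + 'n)"
  where "affine_coupling B\<^sub>R B\<^sub>L P Q\<^sub>R Q\<^sub>L = B\<^sub>R *v Q\<^sub>R - B\<^sub>L *v Q\<^sub>L - P"

definition riemann_solution ::
    "real^'n^'n \<Rightarrow> real^'n^'n \<Rightarrow> (real^('n + 'n) \<Rightarrow> real^('n + 'n) \<Rightarrow> real^('n + 'n))
      \<Rightarrow> (real^('n + 'n)) \<times> (real^('n + 'n)) \<Rightarrow> (real^('n + 'n)) \<times> (real^('n + 'n)) \<Rightarrow> bool"
  where "riemann_solution A\<^sub>1 A\<^sub>2 \<Psi> = (\<lambda>(Q0\<^sub>m, Q0\<^sub>p) (Q\<^sub>R, Q\<^sub>L).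
    Q\<^sub>R \<in> lax_minus A\<^sub>1 Q0\<^sub>m \<and> Q\<^sub>L \<in> lax_plus A\<^sub>2 Q0\<^sub>p \<and> \<Psi> Q\<^sub>R Q\<^sub>L = 0)"

text \<open>The value of the solver at given trace data is meaningful only if \<open>riemann_solution\<close>
  determines exactly one pair there.\<close>

definition riemann_solver ::
    "real^'n^'n \<Rightarrow> real^'n^'n \<Rightarrow> (real^('n + 'n) \<Rightarrow> real^('n + 'n) \<Rightarrow> real^('n + 'n))
      \<Rightarrow> (real^('n + 'n)) \<times> (real^('n + 'n)) \<Rightarrow> (real^('n + 'n)) \<times> (real^('n + 'n))"
  where "riemann_solver A\<^sub>1 A\<^sub>2 \<Psi> Q0 = (THE Q. riemann_solution A\<^sub>1 A\<^sub>2 \<Psi> Q0 Q)"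

end

theory Submission
  imports Defs
begin

text \<open>The parameters of the two Lax curves are the two halves of a single vector
  \<open>\<Sigma>\<close>, and both curves become images of \<open>\<Sigma>\<close> under the padded matrices.
  Inserting this parametrization into the affine coupling condition leaves a square linear system
  for \<open>\<Sigma>\<close>. Distinct \<open>\<Sigma>\<close> might a priori give the same pair of states,
  but the system has only one solution, so the pair is unique as well.\<close>

lemma sum_UNIV_Plus:
  fixes f :: "'a::finite + 'b::finite \<Rightarrow> 'c::comm_monoid_add"
  shows "sum f UNIV = (\<Sum>a\<in>UNIV. f (Inl a)) + (\<Sum>b\<in>UNIV. f (Inr b))"
  by (simp add: UNIV_Plus_UNIV [symmetric] sum.Plus del: UNIV_Plus_UNIV)

text \<open>The zero blocks annihilate the right half of \<open>\<Sigma>\<close>, so the padded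
  matrix acts as the Lax curve matrix on the left half alone. The next lemma is the mirror
  image.\<close>

lemma block_matrix_left_mult_vec:
  "block_matrix A 0 C 0 *v \<Sigma> = block_column A C *v (\<chi> i. \<Sigma> $ Inl i)"
  by (simp add: vec_eq_iff matrix_vector_mult_def block_matrix_def block_column_def
      sum_UNIV_Plus split_sum_all)

lemma block_matrix_right_mult_vec:
  "block_matrix 0 B 0 D *v \<Sigma> = block_column B D *v (\<chi> i. \<Sigma> $ Inr i)"
  by (simp add: vec_eq_iff matrix_vector_mult_def block_matrix_def block_column_def
      sum_UNIV_Plus split_sum_all)

text \<open>The two curve parameters are independent, and the two padded matrices read disjoint
  halves of \<open>\<Sigma>\<close>; hence one vector carries both without restricting
  either.\<close>

lemma lax_curves_common_parameter:
  "Q\<^sub>R \<in> lax_minus A\<^sub>1 Q0\<^sub>m \<and> Q\<^sub>L \<in> lax_plus A\<^sub>2 Q0\<^sub>p \<longleftrightarrow>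
    (\<exists>\<Sigma>. Q\<^sub>R = Q0\<^sub>m + R_tilde_minus A\<^sub>1 *v \<Sigma> \<and>
         Q\<^sub>L = Q0\<^sub>p + R_tilde_plus A\<^sub>2 *v \<Sigma>)"
  (is "?l \<longleftrightarrow> ?r")
proof
  assume ?l
  then obtain S T where "Q\<^sub>R = Q0\<^sub>m + R_minus A\<^sub>1 *v S" "Q\<^sub>L = Q0\<^sub>p + R_plus A\<^sub>2 *v T"
    by (auto simp: lax_minus_def lax_plus_def)
  \<comment> \<open>The witness stacks \<open>S\<close> on top of \<open>T\<close>.\<close>
  then show ?r
    by (intro exI [of _ "\<chi> i. case_sum (($) S) (($) T) i"])
      (simp add: R_tilde_minus_def R_tilde_plus_def R_minus_def R_plus_def
        block_matrix_left_mult_vec block_matrix_right_mult_vec)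
next
  assume ?r
  then show ?l
    by (auto simp: lax_minus_def lax_plus_def R_tilde_minus_def R_tilde_plus_def
        R_minus_def R_plus_def block_matrix_left_mult_vec block_matrix_right_mult_vec)
qed

text \<open>By linearity the terms in \<open>\<Sigma>\<close> collect into one matrix, and the
  constant terms move to the right-hand side.\<close>

lemma affine_coupling_eq_0_iff:
  "affine_coupling B\<^sub>R B\<^sub>L P (q + M *v \<Sigma>) (q' + N *v \<Sigma>) = 0 \<longleftrightarrow>
    (B\<^sub>R ** M - B\<^sub>L ** N) *v \<Sigma> = P + B\<^sub>L *v q' - B\<^sub>R *v q"
  by (auto simp: affine_coupling_def matrix_vector_right_distrib matrix_vector_mult_diff_rdistrib
      matrix_vector_mul_assoc algebra_simps)

lemma riemann_solution_affine_iff: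
  "riemann_solution A\<^sub>1 A\<^sub>2 (affine_coupling B\<^sub>R B\<^sub>L P) (Q0\<^sub>m, Q0\<^sub>p) Q \<longleftrightarrow>
    (\<exists>\<Sigma>. (B\<^sub>R ** R_tilde_minus A\<^sub>1 - B\<^sub>L ** R_tilde_plus A\<^sub>2) *v \<Sigma>
            = P + B\<^sub>L *v Q0\<^sub>p - B\<^sub>R *v Q0\<^sub>m \<and>
         Q = (Q0\<^sub>m + R_tilde_minus A\<^sub>1 *v \<Sigma>, Q0\<^sub>p + R_tilde_plus A\<^sub>2 *v \<Sigma>))"
proof (cases Q)
  case (Pair Q\<^sub>R Q\<^sub>L)
  have "riemann_solution A\<^sub>1 A\<^sub>2 (affine_coupling B\<^sub>R B\<^sub>L P) (Q0\<^sub>m, Q0\<^sub>p) Q \<longleftrightarrow>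
    (\<exists>\<Sigma>. Q\<^sub>R = Q0\<^sub>m + R_tilde_minus A\<^sub>1 *v \<Sigma> \<and>
         Q\<^sub>L = Q0\<^sub>p + R_tilde_plus A\<^sub>2 *v \<Sigma>) \<and> affine_coupling B\<^sub>R B\<^sub>L P Q\<^sub>R Q\<^sub>L = 0"
    \<comment> \<open>Reassociating the conjunction groups the two curve memberships, so that the
      common parameter can be introduced.\<close>
    by (simp add: riemann_solution_def Pair lax_curves_common_parameter flip: conj_assoc)
  then show ?thesis
    unfolding Pair by (auto simp: affine_coupling_eq_0_iff)
qed

lemma invertible_ex1_mult_vec_eq:
  fixes M :: "'a::field^'n^'n"
  assumes "invertible M"
  shows "\<exists>!x. M *v x = b"
proof -
  obtain N where N: "M ** N = mat 1" "N ** M = mat 1"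
    using assms by (auto simp: invertible_def)
  show ?thesis
  proof
    show "M *v (N *v b) = b"
      by (simp add: matrix_vector_mul_assoc N)
    \<comment> \<open>Replacing \<open>b\<close> by \<open>M *v x\<close> turns the right-hand side
      into \<open>(N ** M) *v x\<close>, which is \<open>x\<close>.\<close>
    show "x = N *v b" if "M *v x = b" for x
      by (simp add: matrix_vector_mul_assoc N flip: that)
  qed
qed

theorem proposition1:
  fixes A\<^sub>1 A\<^sub>2 :: "real^'n^'n"
    and B\<^sub>R B\<^sub>L :: "real^('n + 'n)^('n + 'n)"
    and P :: "real^('n + 'n)"
  assumes "diagonal_matrix A\<^sub>1" and "\<And>i. A\<^sub>1 $ i $ i > 0"
    and "diagonal_matrix A\<^sub>2" and "\<And>i. A\<^sub>2 $ i $ i > 0"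
    and "invertible (B\<^sub>R ** R_tilde_minus A\<^sub>1 - B\<^sub>L ** R_tilde_plus A\<^sub>2)"
  shows "\<forall>Q0\<^sub>m Q0\<^sub>p.
    (\<exists>!Q. riemann_solution A\<^sub>1 A\<^sub>2 (affine_coupling B\<^sub>R B\<^sub>L P) (Q0\<^sub>m, Q0\<^sub>p) Q) \<and>
    (\<exists>!\<Sigma>. (B\<^sub>R ** R_tilde_minus A\<^sub>1 - B\<^sub>L ** R_tilde_plus A\<^sub>2) *v \<Sigma>
            = P + B\<^sub>L *v Q0\<^sub>p - B\<^sub>R *v Q0\<^sub>m) \<and>
    (\<forall>\<Sigma>. (B\<^sub>R ** R_tilde_minus A\<^sub>1 - B\<^sub>L ** R_tilde_plus A\<^sub>2) *v \<Sigma>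
            = P + B\<^sub>L *v Q0\<^sub>p - B\<^sub>R *v Q0\<^sub>m \<longrightarrow>
      riemann_solver A\<^sub>1 A\<^sub>2 (affine_coupling B\<^sub>R B\<^sub>L P) (Q0\<^sub>m, Q0\<^sub>p)
        = (Q0\<^sub>m + R_tilde_minus A\<^sub>1 *v \<Sigma>, Q0\<^sub>p + R_tilde_plus A\<^sub>2 *v \<Sigma>))"
proof (intro allI)
  fix Q0\<^sub>m Q0\<^sub>p
  let ?sys = "\<lambda>\<Sigma>. (B\<^sub>R ** R_tilde_minus A\<^sub>1 - B\<^sub>L ** R_tilde_plus A\<^sub>2) *v \<Sigma>
            = P + B\<^sub>L *v Q0\<^sub>p - B\<^sub>R *v Q0\<^sub>m"
  let ?sol = "riemann_solution A\<^sub>1 A\<^sub>2 (affine_coupling B\<^sub>R B\<^sub>L P) (Q0\<^sub>m, Q0\<^sub>p)"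
  let ?out = "\<lambda>\<Sigma>. (Q0\<^sub>m + R_tilde_minus A\<^sub>1 *v \<Sigma>, Q0\<^sub>p + R_tilde_plus A\<^sub>2 *v \<Sigma>)"
  have ex1: "\<exists>!\<Sigma>. ?sys \<Sigma>"
    using assms(5) by (rule invertible_ex1_mult_vec_eq)
  have sol: "?sol Q \<longleftrightarrow> Q = ?out \<Sigma>" if "?sys \<Sigma>" for Q \<Sigma>
    unfolding riemann_solution_affine_iff using ex1 that by blast
  from ex1 obtain \<Sigma>\<^sub>0 where "?sys \<Sigma>\<^sub>0"
    by blast
  \<comment> \<open>With \<open>sol\<close> at \<open>\<Sigma>\<^sub>0\<close>, being a solution
    pair means being equal to one fixed pair.\<close>
  then have "\<exists>!Q. ?sol Q"
    by (simp only: sol ex1_eq)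
  moreover have "riemann_solver A\<^sub>1 A\<^sub>2 (affine_coupling B\<^sub>R B\<^sub>L P) (Q0\<^sub>m, Q0\<^sub>p) = ?out \<Sigma>"
    if "?sys \<Sigma>" for \<Sigma>
    unfolding riemann_solver_def by (rule the_equality) (simp_all only: sol [OF that])
  ultimately show "(\<exists>!Q. ?sol Q) \<and> (\<exists>!\<Sigma>. ?sys \<Sigma>) \<and>
    (\<forall>\<Sigma>. ?sys \<Sigma> \<longrightarrow>
      riemann_solver A\<^sub>1 A\<^sub>2 (affine_coupling B\<^sub>R B\<^sub>L P) (Q0\<^sub>m, Q0\<^sub>p) = ?out \<Sigma>)"
    using ex1 by blast
qed

end
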